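(* Suppose that $i$ is a sink in the quiver $Q$ and $j$ is a source so that, for any other vertex $k$, the number $n_k$ of arrows from $k$ to $i$ is equal to the number of arrows from $j$ to $k$. Then the frieze variety $X(Q)$ is contained in the union of two hypersurfaces $X_0,X_1$ given by the equations $F_0=0$ and $F_1=0$, where $$F_0=1-2x_ix_j+\prod_k x_k^{n_k},\qquad F_1=2-x_ix_j+2\prod_k x_k^{n_k},$$ the products being over the other vertices $k$.
   Context: $Q$ is a connected finite quiver without oriented cycles (multiple arrows allowed), with vertices labelled $1,\dots,n$ so that if there is an arrow $i\to j$ then $i>j$. Define positive rational numbers $f_i(t)$ for each vertex $i$ and each integer $t\ge 0$ recursively by $f_i(0)=1$ and $$f_i(t+1)=\frac{1+\prod_{j\to i}f_j(t)\prod_{j\leftarrow i}f_j(t+1)}{f_i(t)},$$ the products running over all arrows of $Q$ ending at $i$, respectively starting at $i$, counted with multiplicity. Put $P_t=(f_1(t),\dots,f_n(t))\in\mathbb{C}^n$. The frieze variety $X(Q)$ is the Zariski closure in $\mathbb{C}^n$ of the set of all points $P_t$, $t\ge 0$. The coordinates on $\mathbb{C}^n$ are $x_1,\dots,x_n$.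
   Formalization: The formal statement additionally assumes that there is no arrow from the source j directly to the sink i; with such arrows the claim fails already at P_1 (e.g. two arrows j→i: x_i=2, x_j=5, F_0=-18, F_1=-6). *)

theory Defs
  imports
    "HOL-Analysis.Finite_Cartesian_Product"
    "HOL-Library.Poly_Mapping"
    "Graph_Theory.Digraph_Component"
begin

text \<open>
  A quiver is a multidigraph of the AFP library. Its vertices \<open>1,\<dots>,n\<close> are rendered as
  the elements of a finite linearly ordered type \<open>'n\<close> with \<open>n = CARD('n)\<close>, so that
  \<open>\<complex>\<^sup>n\<close> is \<^typ>\<open>complex ^ 'n\<close>.
\<close>

locale labelled_quiver = fin_digraph Q
  for Q :: "('n :: {finite, linorder}, 'b) pre_digraph" +
  assumes verts_UNIV: "verts Q = UNIV"
    and connected: "Digraph_Component.connected Q"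
    and acyclic: "acyclic (arcs_ends Q)"
    and labelling: "a \<in> arcs Q \<Longrightarrow> head Q a < tail Q a"

definition num_arrows :: "('n, 'b) pre_digraph \<Rightarrow> 'n \<Rightarrow> 'n \<Rightarrow> nat" where
  "num_arrows Q k l = card {a \<in> arcs Q. tail Q a = k \<and> head Q a = l}"

definition sink :: "('n, 'b) pre_digraph \<Rightarrow> 'n \<Rightarrow> bool" where
  "sink Q i \<longleftrightarrow> i \<in> verts Q \<and> out_arcs Q i = {}"

definition source :: "('n, 'b) pre_digraph \<Rightarrow> 'n \<Rightarrow> bool" where
  "source Q j \<longleftrightarrow> j \<in> verts Q \<and> in_arcs Q j = {}"


text \<open>
  The recursion terminates because \<open>f\<^sub>i(t+1)\<close> refers to time \<open>t+1\<close> only at heads of arrows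
  starting at \<open>i\<close>, which have smaller labels.
\<close>

context labelled_quiver
begin

function frieze :: "'n \<Rightarrow> nat \<Rightarrow> rat" where
  "frieze i 0 = 1"
| "frieze i (Suc t) =
     (1 + (\<Prod>a\<in>in_arcs Q i. frieze (tail Q a) t)
        * (\<Prod>a\<in>out_arcs Q i. frieze (head Q a) (Suc t))) / frieze i t"
  by pat_completeness auto
termination
proof (relation "measures [\<lambda>(i, t). t, \<lambda>(i, t). card {..<i}]")
  fix i :: 'n and t :: nat and a
  assume "a \<in> out_arcs Q i"
  then have "head Q a < i"
    using labelling unfolding out_arcs_def by blast
  then have "{..<head Q a} \<subset> {..<i}"
    by (simp add: lessThan_strict_subset_iff)
  then have "card {..<head Q a} < card {..<i}"
    by (intro psubset_card_mono) simp
  then show "((head Q a, Suc t), (i, Suc t)) \<in> measures [\<lambda>(i, t). t, \<lambda>(i, t). card {..<i}]"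
    by simp
qed simp_all

text \<open>As a rewrite rule the second equation loops on its own right-hand side.\<close>

declare frieze.simps(2) [simp del]

lemma frieze_pos: "frieze i t > 0"
proof (induction i t rule: frieze.induct)
  case (2 i t)
  have "(\<Prod>a\<in>in_arcs Q i. frieze (tail Q a) t) \<ge> 0"
    by (rule prod_nonneg) (rule less_imp_le, rule 2)
  moreover have "(\<Prod>a\<in>out_arcs Q i. frieze (head Q a) (Suc t)) \<ge> 0"
    by (rule prod_nonneg) (rule less_imp_le, rule 2)
  ultimately have "1 + (\<Prod>a\<in>in_arcs Q i. frieze (tail Q a) t)
      * (\<Prod>a\<in>out_arcs Q i. frieze (head Q a) (Suc t)) > 0"
    by (rule add_pos_nonneg[OF zero_less_one mult_nonneg_nonneg])
  moreover have "frieze i t > 0"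
    by (rule 2)
  ultimately show ?case
    by (subst frieze.simps(2)) (rule divide_pos_pos)
qed simp

definition frieze_point :: "nat \<Rightarrow> complex ^ ('n :: {finite, linorder})" where
  "frieze_point t = (\<chi> i. of_rat (frieze i t))"

end


text \<open>Polynomials in the variables \<open>x\<^sub>k\<close>: finitely supported families of coefficients indexed by
  monomials, a monomial being a finitely supported family of exponents.\<close>

type_synonym 'n cpoly = "('n \<Rightarrow>\<^sub>0 nat) \<Rightarrow>\<^sub>0 complex"

definition const_poly :: "complex \<Rightarrow> 'n cpoly" where
  "const_poly c = Poly_Mapping.single 0 c"

definition var_poly :: "'n \<Rightarrow> 'n cpoly" where
  "var_poly k = Poly_Mapping.single (Poly_Mapping.single k 1) 1"

definition eval_poly :: "('n :: finite) cpoly \<Rightarrow> complex ^ 'n \<Rightarrow> complex" where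
  "eval_poly p x =
     (\<Sum>m\<in>Poly_Mapping.keys p.
        Poly_Mapping.lookup p m * (\<Prod>k\<in>UNIV. (x $ k) ^ Poly_Mapping.lookup m k))"

definition zero_locus :: "('n :: finite) cpoly set \<Rightarrow> (complex ^ 'n) set" where
  "zero_locus I = {x. \<forall>p\<in>I. eval_poly p x = 0}"

definition zariski_closed :: "(complex ^ 'n :: finite) set \<Rightarrow> bool" where
  "zariski_closed S \<longleftrightarrow> (\<exists>I. S = zero_locus I)"

definition zariski_closure :: "(complex ^ 'n :: finite) set \<Rightarrow> (complex ^ 'n) set" where
  "zariski_closure S = \<Inter>{V. zariski_closed V \<and> S \<subseteq> V}"

definition hypersurface :: "(complex ^ 'n :: finite) set \<Rightarrow> bool" where
  "hypersurface X \<longleftrightarrow> (\<exists>p. p \<notin> range const_poly \<and> X = zero_locus {p})"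

definition (in labelled_quiver) frieze_variety :: "(complex ^ ('n :: {finite, linorder})) set" where
  "frieze_variety = zariski_closure (range frieze_point)"

end

theory Submission
  imports Defs
begin

text \<open>
  Write \<open>a\<^sub>t, b\<^sub>t\<close> for the frieze values at the sink and at the source at time \<open>t\<close>, and
  \<open>m\<^sub>t\<close> for the value of \<open>\<Prod>\<^sub>k x\<^sub>k\<^bsup>n\<^sub>k\<^esup>\<close> there. At a sink the recursion
  uses only values from time \<open>t\<close>, at a source only values from time \<open>t + 1\<close>, so the hypothesis on
  the arrow numbers gives
  \<open>a\<^sub>t\<^sub>+\<^sub>1 a\<^sub>t = 1 + m\<^sub>t\<close> and \<open>b\<^sub>t\<^sub>+\<^sub>1 b\<^sub>t = 1 + m\<^sub>t\<^sub>+\<^sub>1\<close>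
  with the same function \<open>m\<close>. Hence if \<open>a\<^sub>t b\<^sub>t = c (1 + m\<^sub>t)\<close>, then
  \<open>a\<^sub>t\<^sub>+\<^sub>1 = b\<^sub>t / c\<close> and therefore
  \<open>a\<^sub>t\<^sub>+\<^sub>1 b\<^sub>t\<^sub>+\<^sub>1 = (1 + m\<^sub>t\<^sub>+\<^sub>1) / c\<close>: one time step replaces \<open>c\<close>
  by \<open>1 / c\<close>. At time \<open>0\<close> all values are \<open>1\<close>, so \<open>c = 1/2\<close>, and \<open>c\<close> alternates between
  \<open>1/2\<close> and \<open>2\<close> (\<open>frieze_sink_source_alternates\<close>). These two values of \<open>c\<close> are the equations
  \<open>F\<^sub>0 = 0\<close> and \<open>F\<^sub>1 = 0\<close>.

  The union of the two zero loci is the zero locus of \<open>F\<^sub>0 F\<^sub>1\<close>, hence Zariski closed, so it contains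
  the closure as well as the points. Both zero loci are hypersurfaces because changing
  \<open>x\<^sub>i\<close> and \<open>x\<^sub>j\<close> from \<open>0\<close> to \<open>1\<close>, all other coordinates being fixed, changes the values of
  \<open>F\<^sub>0\<close> and \<open>F\<^sub>1\<close>.
\<close>

section \<open>Evaluation as a ring homomorphism\<close>

text \<open>Summing over a set that does not depend on \<open>p\<close> makes evaluation visibly linear: cancellation
  can make the support of a sum smaller than the union of the supports.\<close>

lemma eval_poly_superset:
  assumes "finite A" and "Poly_Mapping.keys p \<subseteq> A"
  shows "eval_poly p x =
    (\<Sum>m\<in>A. Poly_Mapping.lookup p m * (\<Prod>k\<in>UNIV. (x $ k) ^ Poly_Mapping.lookup m k))"
  unfolding eval_poly_def
  by (rule sum.mono_neutral_left) (use assms in \<open>auto simp: in_keys_iff\<close>)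

lemma eval_poly_add: "eval_poly (p + q) x = eval_poly p x + eval_poly q x"
proof -
  let ?A = "Poly_Mapping.keys p \<union> Poly_Mapping.keys q"
  have "Poly_Mapping.keys (p + q) \<subseteq> ?A"
    by (rule Poly_Mapping.keys_add)
  then show ?thesis
    by (simp add: eval_poly_superset[of ?A] lookup_add sum.distrib distrib_right)
qed

lemma eval_poly_single:
  "eval_poly (Poly_Mapping.single m c) x = c * (\<Prod>k\<in>UNIV. (x $ k) ^ Poly_Mapping.lookup m k)"
  by (simp add: eval_poly_def)

lemma eval_poly_uminus: "eval_poly (- p) x = - eval_poly p x"
  by (simp add: eval_poly_def keys_minus sum_negf)

lemma eval_poly_diff: "eval_poly (p - q) x = eval_poly p x - eval_poly q x"
  using eval_poly_add[of p "- q" x] by (simp add: eval_poly_uminus)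

text \<open>A term may be added without regard to the support of the rest. Applied to each factor in turn,
  this reduces multiplicativity of evaluation to products of two terms.\<close>

lemma poly_mapping_term_induct [case_names zero term_plus]:
  assumes "P 0" and "\<And>m c p. P p \<Longrightarrow> P (Poly_Mapping.single m c + p)"
  shows "P p"
proof (induction p rule: update_induct)
  case const
  show ?case by fact
next
  case (update p m c)
  have "Poly_Mapping.update m c p = Poly_Mapping.single m c + p"
    using update(1)
    by (intro poly_mapping_eqI) (auto simp: lookup_update lookup_add lookup_single when_def in_keys_iff)
  with assms(2) update show ?case by simp
qed

lemma eval_poly_mult: "eval_poly (p * q) x = eval_poly p x * eval_poly q x"
proof (induction p rule: poly_mapping_term_induct)
  case zero
  show ?case by (simp add: eval_poly_def)
next
  case (term_plus m c p)
  have "eval_poly (Poly_Mapping.single m c * q) x = eval_poly (Poly_Mapping.single m c) x * eval_poly q x"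
  proof (induction q rule: poly_mapping_term_induct)
    case zero
    show ?case by (simp add: eval_poly_def)
  next
    case (term_plus m' c' q)
    then show ?case
      by (simp add: distrib_left eval_poly_add mult_single eval_poly_single lookup_add power_add
          prod.distrib)
  qed
  with term_plus show ?case
    by (simp add: distrib_right eval_poly_add)
qed

lemma eval_poly_const: "eval_poly (const_poly c) x = c"
  by (simp add: const_poly_def eval_poly_single)

lemma eval_poly_one: "eval_poly 1 x = 1"
  using eval_poly_const[of 1 x] by (simp add: const_poly_def)

lemma eval_poly_numeral: "eval_poly (numeral w) x = numeral w"
  by (induction w) (simp_all only: numeral.simps eval_poly_add eval_poly_one)

lemma eval_poly_var: "eval_poly (var_poly k) x = x $ k"
proof -
  have "(\<Prod>l\<in>UNIV. (x $ l) ^ Poly_Mapping.lookup (Poly_Mapping.single k 1) l)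
      = (\<Prod>l\<in>UNIV. if l = k then x $ l else 1)"
    by (rule prod.cong) (auto simp: lookup_single when_def)
  then show ?thesis
    by (simp add: var_poly_def eval_poly_single)
qed

lemma eval_poly_power: "eval_poly (p ^ e) x = eval_poly p x ^ e"
  by (induction e) (simp_all add: eval_poly_one eval_poly_mult)

lemma eval_poly_prod: "eval_poly (\<Prod>k\<in>A. p k) x = (\<Prod>k\<in>A. eval_poly (p k) x)"
  by (induction A rule: infinite_finite_induct) (simp_all add: eval_poly_one eval_poly_mult)

lemmas eval_poly_hom =
  eval_poly_add eval_poly_diff eval_poly_mult eval_poly_one eval_poly_numeral
  eval_poly_var eval_poly_power eval_poly_prod

section \<open>Hypersurfaces and the Zariski closure\<close>

lemma hypersurface_if_nonconstant:
  assumes "eval_poly p x \<noteq> eval_poly p y"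
  shows "hypersurface (zero_locus {p})"
  unfolding hypersurface_def using assms by (intro exI[of _ p]) (auto simp: eval_poly_const)

lemma zero_locus_mult: "zero_locus {p * q} = zero_locus {p} \<union> zero_locus {q}"
  by (auto simp: zero_locus_def eval_poly_mult)

lemma zariski_closure_subset_Un:
  assumes "S \<subseteq> zero_locus {p} \<union> zero_locus {q}"
  shows "zariski_closure S \<subseteq> zero_locus {p} \<union> zero_locus {q}"
proof -
  have "zariski_closed (zero_locus {p} \<union> zero_locus {q})"
    by (auto simp: zariski_closed_def simp flip: zero_locus_mult)
  with assms show ?thesis
    by (auto simp: zariski_closure_def)
qed

section \<open>Sinks and sources in the frieze recursion\<close>

context labelled_quiver
begin

text \<open>The recursion multiplies over arrows, the hypersurfaces are given by products over vertices:
  collecting parallel arrows turns one into the other.\<close>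

lemma prod_in_arcs:
  "(\<Prod>a\<in>in_arcs Q l. g (tail Q a)) = (\<Prod>k\<in>UNIV. g k ^ num_arrows Q k l)"
proof -
  have "(\<Prod>a\<in>in_arcs Q l. g (tail Q a))
      = (\<Prod>k\<in>UNIV. \<Prod>a\<in>{a \<in> in_arcs Q l. tail Q a = k}. g (tail Q a))"
    by (rule prod.group[symmetric]) auto
  also have "\<dots> = (\<Prod>k\<in>UNIV. g k ^ num_arrows Q k l)"
    by (intro prod.cong refl)
       (simp add: num_arrows_def in_arcs_def conj_commute conj_left_commute conj_assoc)
  finally show ?thesis .
qed

lemma prod_out_arcs:
  "(\<Prod>a\<in>out_arcs Q k. g (head Q a)) = (\<Prod>l\<in>UNIV. g l ^ num_arrows Q k l)"
proof -
  have "(\<Prod>a\<in>out_arcs Q k. g (head Q a))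
      = (\<Prod>l\<in>UNIV. \<Prod>a\<in>{a \<in> out_arcs Q k. head Q a = l}. g (head Q a))"
    by (rule prod.group[symmetric]) auto
  also have "\<dots> = (\<Prod>l\<in>UNIV. g l ^ num_arrows Q k l)"
    by (intro prod.cong refl) (simp add: num_arrows_def out_arcs_def conj_assoc)
  finally show ?thesis .
qed

lemma num_arrows_from_sink: "sink Q i \<Longrightarrow> num_arrows Q i k = 0"
  by (auto simp: sink_def num_arrows_def out_arcs_def)

lemma num_arrows_to_source: "source Q j \<Longrightarrow> num_arrows Q k j = 0"
  by (auto simp: source_def num_arrows_def in_arcs_def)

lemma frieze_sink_step:
  assumes "sink Q i"
  shows "frieze i (Suc t) * frieze i t = 1 + (\<Prod>k\<in>UNIV. frieze k t ^ num_arrows Q k i)"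
  using assms frieze_pos[of i t]
  by (subst frieze.simps(2)) (simp add: sink_def prod_in_arcs[where g = "\<lambda>k. frieze k t"])

lemma frieze_source_step:
  assumes "source Q j"
  shows "frieze j (Suc t) * frieze j t = 1 + (\<Prod>k\<in>UNIV. frieze k (Suc t) ^ num_arrows Q j k)"
  using assms frieze_pos[of j t]
  by (subst frieze.simps(2)) (simp add: source_def prod_out_arcs[where g = "\<lambda>k. frieze k (Suc t)"])

text \<open>Comparing \<open>a\<^sub>t\<^sub>+\<^sub>1 a\<^sub>t = 1 + m\<^sub>t\<close> with the relation at time \<open>t\<close> expresses the next value at
  the sink as a multiple of the current value at the source, and the source relation then yields the
  claim at time \<open>t + 1\<close>. The argument covers \<open>i = j\<close>: such a vertex is isolated, \<open>m\<close> is
  identically \<open>1\<close>, and the values there alternate between \<open>1\<close> and \<open>2\<close>.\<close>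

lemma frieze_sink_source_alternates:
  assumes "sink Q i" and "source Q j"
    and "\<And>k. k \<noteq> i \<Longrightarrow> k \<noteq> j \<Longrightarrow> num_arrows Q k i = num_arrows Q j k"
    and "num_arrows Q j i = 0"
  defines "m t \<equiv> \<Prod>k\<in>UNIV - {i, j}. frieze k t ^ num_arrows Q k i"
  shows "frieze i t * frieze j t = (if even t then (1 + m t) / 2 else 2 * (1 + m t))"
proof (induction t)
  case 0
  show ?case by (simp add: m_def)
next
  case (Suc t)
  have "(\<Prod>k\<in>UNIV. frieze k t ^ num_arrows Q k i) = m t"
    unfolding m_def using assms(1,4)
    by (intro prod.mono_neutral_right) (auto simp: num_arrows_from_sink)
  with frieze_sink_step[OF assms(1)]
  have sink_step: "frieze i (Suc t) * frieze i t = 1 + m t" by simp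
  have "(\<Prod>k\<in>UNIV. frieze k (Suc t) ^ num_arrows Q j k)
      = (\<Prod>k\<in>UNIV - {i, j}. frieze k (Suc t) ^ num_arrows Q j k)"
    using assms(2,4)
    by (intro prod.mono_neutral_right) (auto simp: num_arrows_to_source)
  also have "\<dots> = m (Suc t)"
    unfolding m_def by (intro prod.cong) (simp_all add: assms(3))
  finally have source_step: "frieze j (Suc t) * frieze j t = 1 + m (Suc t)"
    using frieze_source_step[OF assms(2)] by simp
  have pos: "frieze i t \<noteq> 0"
    using frieze_pos[of i t] by simp
  show ?case
  proof (cases "even t")
    case True
    with Suc.IH have "1 + m t = 2 * (frieze i t * frieze j t)" by simp
    with sink_step pos have "frieze i (Suc t) = 2 * frieze j t" by simp
    with True source_step show ?thesis by (simp add: mult_ac)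
  next
    case False
    with Suc.IH have "1 + m t = frieze i t * frieze j t / 2" by simp
    with sink_step pos have "frieze j t = 2 * frieze i (Suc t)" by (simp add: field_simps)
    with False source_step show ?thesis by (simp add: mult_ac)
  qed
qed

end

section \<open>The frieze variety\<close>

theorem proposition6p2:
  fixes Q :: "('n :: {finite, linorder}, 'b) pre_digraph" and i j :: 'n
  assumes "labelled_quiver Q"
    and "sink Q i"
    and "source Q j"
    and "\<And>k. k \<noteq> i \<Longrightarrow> k \<noteq> j \<Longrightarrow> num_arrows Q k i = num_arrows Q j k"
    and "num_arrows Q j i = 0"
  shows "let M = (\<Prod>k\<in>UNIV - {i, j}. var_poly k ^ num_arrows Q k i);
             F\<^sub>0 = 1 - 2 * var_poly i * var_poly j + M;
             F\<^sub>1 = 2 - var_poly i * var_poly j + 2 * M;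
             X\<^sub>0 = zero_locus {F\<^sub>0};
             X\<^sub>1 = zero_locus {F\<^sub>1}
         in hypersurface X\<^sub>0 \<and> hypersurface X\<^sub>1
          \<and> labelled_quiver.frieze_variety Q \<subseteq> X\<^sub>0 \<union> X\<^sub>1"
proof -
  interpret labelled_quiver Q by fact
  define M where "M = (\<Prod>k\<in>UNIV - {i, j}. var_poly k ^ num_arrows Q k i)"
  define F\<^sub>0 where "F\<^sub>0 = 1 - 2 * var_poly i * var_poly j + M"
  define F\<^sub>1 where "F\<^sub>1 = 2 - var_poly i * var_poly j + 2 * M"
  have eval_M: "eval_poly M x = (\<Prod>k\<in>UNIV - {i, j}. (x $ k) ^ num_arrows Q k i)" for x
    by (simp add: M_def eval_poly_hom)
  have eval_F0: "eval_poly F\<^sub>0 x = 1 - 2 * (x $ i) * (x $ j) + eval_poly M x" for x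
    by (simp add: F\<^sub>0_def eval_poly_hom)
  have eval_F1: "eval_poly F\<^sub>1 x = 2 - (x $ i) * (x $ j) + 2 * eval_poly M x" for x
    by (simp add: F\<^sub>1_def eval_poly_hom)

  \<comment> \<open>Two points that agree in every variable of \<open>M\<close>, but on which \<open>x\<^sub>i x\<^sub>j\<close> takes the
    values \<open>0\<close> and \<open>1\<close>.\<close>
  define x y :: "complex ^ ('n :: {finite, linorder})"
    where "x = 0" and "y = (\<chi> k. if k \<in> {i, j} then 1 else 0)"
  have M_eq: "eval_poly M x = eval_poly M y"
    unfolding eval_M by (rule prod.cong) (auto simp: x_def y_def)
  have "eval_poly F\<^sub>0 x \<noteq> eval_poly F\<^sub>0 y" and "eval_poly F\<^sub>1 x \<noteq> eval_poly F\<^sub>1 y"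
    by (simp_all add: eval_F0 eval_F1 M_eq) (simp_all add: x_def y_def)
  then have hyp: "hypersurface (zero_locus {F\<^sub>0})" "hypersurface (zero_locus {F\<^sub>1})"
    by (auto intro: hypersurface_if_nonconstant)

  have "frieze_point t \<in> zero_locus {F\<^sub>0} \<union> zero_locus {F\<^sub>1}" for t
  proof -
    define m where "m = (\<Prod>k\<in>UNIV - {i, j}. frieze k t ^ num_arrows Q k i)"
    have eval_M_point: "eval_poly M (frieze_point t) = of_rat m"
      by (simp add: eval_M m_def frieze_point_def of_rat_prod of_rat_power)
    have alt: "frieze i t * frieze j t = (if even t then (1 + m) / 2 else 2 * (1 + m))"
      unfolding m_def by (rule frieze_sink_source_alternates) fact+
    show ?thesis
    proof (cases "even t")
      case True
      with alt have "1 - 2 * frieze i t * frieze j t + m = 0" by (simp add: mult.assoc)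
      then have "of_rat (1 - 2 * frieze i t * frieze j t + m) = (0 :: complex)" by simp
      then have "eval_poly F\<^sub>0 (frieze_point t) = 0"
        unfolding eval_F0 eval_M_point
        by (simp add: frieze_point_def of_rat_add of_rat_diff of_rat_mult)
      then show ?thesis by (simp add: zero_locus_def)
    next
      case False
      with alt have "2 - frieze i t * frieze j t + 2 * m = 0" by simp
      then have "of_rat (2 - frieze i t * frieze j t + 2 * m) = (0 :: complex)" by simp
      then have "eval_poly F\<^sub>1 (frieze_point t) = 0"
        unfolding eval_F1 eval_M_point
        by (simp add: frieze_point_def of_rat_add of_rat_diff of_rat_mult)
      then show ?thesis by (simp add: zero_locus_def)
    qed
  qed
  then have "frieze_variety \<subseteq> zero_locus {F\<^sub>0} \<union> zero_locus {F\<^sub>1}"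
    unfolding frieze_variety_def by (intro zariski_closure_subset_Un) auto
  with hyp show ?thesis
    by (simp add: Let_def F\<^sub>0_def F\<^sub>1_def M_def)
qed

end
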